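(* Let $n \geq 7$ be odd, and let $\omega_n := (1, 3, \ldots, n, n-1, n-3, \ldots, 2)$ be the cyclic order on $\{1,\ldots,n\}$ listing the odd numbers increasingly and then the even numbers decreasingly. Then $C(n,\{2,3\})$ is nearly dispersable with respect to $\omega_n$.
   Context: All graphs are finite and simple. For a set $S=\{i_1<\cdots<i_k\}$ of integers with $k\ge 1$, $1\le i_1$ and $i_k\le \lfloor n/2\rfloor$, the circulant $C(n,S)$ is the graph on vertex set $\{1,\ldots,n\}$ in which each $j$ is adjacent to $j+i_r$ (addition mod $n$) for $r=1,\ldots,k$. Given a graph $G$ and a cyclic order $\omega$ on $V(G)$, draw the vertices on a circle in the order $\omega$ and the edges as straight chords; two edges cross if they intersect at a point that is not an endpoint. A matching book embedding $(G,\omega,c)$ consists of $G$, a cyclic order $\omega$, and an edge-coloring $c$ (the color classes are the pages) such that any two distinct edges of the same color neither cross nor share an endpoint. The embedding is dispersable if the number of colors equals the maximum degree $\Delta(G)$, and nearly dispersable if the number of colors equals $1+\Delta(G)$. A graph is dispersable if it has a dispersable matching book embedding; it is nearly dispersable if it is not dispersable and has a nearly dispersable matching book embedding. "Nearly dispersable with respect to $\omega$" means that the graph $G$ is not dispersable and has a nearly dispersable matching book embedding $(G,\omega,c)$ with this particular cyclic order $\omega$. *)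

theory Defs
  imports "HOL-Analysis.Analysis" "HOL-Number_Theory.Cong"
begin

record 'a sgraph =
  verts :: "'a set"
  edges :: "'a set set"

definition simple_graph :: "'a sgraph \<Rightarrow> bool" where
  "simple_graph G \<longleftrightarrow> finite (verts G) \<and> (\<forall>e\<in>edges G. e \<subseteq> verts G \<and> card e = 2)"

definition degree :: "'a sgraph \<Rightarrow> 'a \<Rightarrow> nat" where
  "degree G v = card {e \<in> edges G. v \<in> e}"

definition max_degree :: "'a sgraph \<Rightarrow> nat" where
  "max_degree G = Max (degree G ` verts G)"

(* Intended for nonempty S contained in {1..n div 2}. *)
definition circulant :: "nat \<Rightarrow> nat set \<Rightarrow> nat sgraph" where
  "circulant n S =
    \<lparr>verts = {1..n},
     edges = {{j, k} | j k. j \<in> {1..n} \<and> k \<in> {1..n} \<and> (\<exists>i\<in>S. [k = j + i] (mod n))}\<rparr>"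

lemma simple_graph_circulant:
  assumes "S \<subseteq> {1..n div 2}"
  shows "simple_graph (circulant n S)"
proof -
  have "j \<noteq> k" if "i \<in> S" "[k = j + i] (mod n)" for i j k :: nat
  proof
    assume "j = k"
    with that have "[i = 0] (mod n)"
      by (metis cong_add_lcancel_0_nat cong_sym)
    then have "n dvd i"
      by (simp add: cong_0_iff)
    moreover have "0 < i" "i \<le> n div 2"
      using that assms by auto
    ultimately show False
      using dvd_imp_le[of n i] by linarith
  qed
  then show ?thesis
    by (fastforce simp: simple_graph_def circulant_def card_2_iff)
qed

(* A cyclic order is given by one of its listings; rotating the list gives another listing of
   the same cyclic order. *)
definition cyclic_order_on :: "'a set \<Rightarrow> 'a list \<Rightarrow> bool" where
  "cyclic_order_on V \<omega> \<longleftrightarrow> distinct \<omega> \<and> set \<omega> = V"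

(* The i-th vertex of the listing is drawn at the i-th of the equally spaced points on the unit
   circle, so that traversing the circle visits the vertices in the given cyclic order. *)
definition circle_point :: "'a list \<Rightarrow> 'a \<Rightarrow> complex" where
  "circle_point \<omega> v =
    cis (2 * pi * real (THE i. i < length \<omega> \<and> \<omega> ! i = v) / real (length \<omega>))"

(* For a two-element set e this is the closed segment joining the points of its endpoints. *)
definition chord :: "'a list \<Rightarrow> 'a set \<Rightarrow> complex set" where
  "chord \<omega> e = convex hull (circle_point \<omega> ` e)"

definition edges_cross :: "'a list \<Rightarrow> 'a set \<Rightarrow> 'a set \<Rightarrow> bool" where
  "edges_cross \<omega> e f \<longleftrightarrow>
    (\<exists>p \<in> chord \<omega> e \<inter> chord \<omega> f. p \<notin> circle_point \<omega> ` (e \<union> f))"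

definition matching_book_embedding ::
    "'a sgraph \<Rightarrow> 'a list \<Rightarrow> ('a set \<Rightarrow> nat) \<Rightarrow> bool" where
  "matching_book_embedding G \<omega> c \<longleftrightarrow>
    simple_graph G \<and> cyclic_order_on (verts G) \<omega> \<and>
    (\<forall>e\<in>edges G. \<forall>f\<in>edges G. e \<noteq> f \<and> c e = c f \<longrightarrow> \<not> edges_cross \<omega> e f \<and> e \<inter> f = {})"

(* Pages are the nonempty colour classes, so only colours actually used are counted. *)
definition num_pages :: "'a sgraph \<Rightarrow> ('a set \<Rightarrow> nat) \<Rightarrow> nat" where
  "num_pages G c = card (c ` edges G)"

definition dispersable :: "'a sgraph \<Rightarrow> bool" where
  "dispersable G \<longleftrightarrow>
    (\<exists>\<omega> c. matching_book_embedding G \<omega> c \<and> num_pages G c = max_degree G)"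

definition nearly_dispersable_wrt :: "'a sgraph \<Rightarrow> 'a list \<Rightarrow> bool" where
  "nearly_dispersable_wrt G \<omega> \<longleftrightarrow>
    \<not> dispersable G \<and>
    (\<exists>c. matching_book_embedding G \<omega> c \<and> num_pages G c = 1 + max_degree G)"

(* For odd n: 1, 3, ..., n, n - 1, n - 3, ..., 2. *)
definition odd_even_order :: "nat \<Rightarrow> nat list" where
  "odd_even_order n = filter odd [1..<n + 1] @ rev (filter even [1..<n + 1])"

lemma cyclic_order_on_odd_even_order:
  "cyclic_order_on (verts (circulant n S)) (odd_even_order n)"
  by (auto simp: cyclic_order_on_def circulant_def odd_even_order_def)

end

theory Submission
  imports Defs
begin

text \<open>
  A page is a matching on an odd number of vertices, so it has at most \<open>(n - 1) / 2\<close> edges and four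
  pages hold at most \<open>2 n - 2\<close> of the \<open>2 n\<close> edges; the graph is 4-regular, so it is not dispersable.

  For five pages, note that in the order \<open>\<omega>\<^sub>n\<close> the edges \<open>{a, a + 2}\<close> are sides of the polygon, so
  they cross nothing. The edges \<open>{a, a + 3}\<close> with \<open>a\<close> odd are pairwise parallel, and so are those
  with \<open>a\<close> even; they take one page each. The sides on the odd and on the even half of the circle
  alternate between two further pages, which also hold \<open>{1, n - 1}, {3, n}\<close> and
  \<open>{1, n - 2}, {2, n}\<close> respectively, and a fifth page holds \<open>{2, n - 1}\<close> and a side that corrects
  the parity of the alternation; the two end sides \<open>{1, 3}\<close> and \<open>{n - 2, n}\<close> fit on the pages of
  the edges \<open>{a, a + 3}\<close>.
\<close>

section \<open>Crossing of chords in terms of positions on the circle\<close>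

lemma circle_point_nth:
  assumes "distinct \<omega>" "i < length \<omega>"
  shows "circle_point \<omega> (\<omega> ! i) = cis (2 * pi * real i / real (length \<omega>))"
proof -
  have "(THE k. k < length \<omega> \<and> \<omega> ! k = \<omega> ! i) = i"
    using assms nth_eq_iff_index_eq by blast
  then show ?thesis
    by (simp add: circle_point_def)
qed

text \<open>The line through the circle points at angles \<alpha> and \<beta> has unit normal
  \<open>cis ((\<alpha> + \<beta>) / 2)\<close> and offset
  \<open>cos ((\<alpha> - \<beta>) / 2)\<close>. The left side is thus the signed distance from this
  line of the point at angle \<theta>; the product form lets its sign be read off from two
  sines.\<close>

lemma cos_diff_cos_half:
  fixes \<alpha> \<beta> \<theta> :: real
  shows "cos ((\<alpha> - \<beta>) / 2) - cos (\<theta> - (\<alpha> + \<beta>) / 2) =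
    2 * (sin ((\<theta> - \<alpha>) / 2) * sin ((\<theta> - \<beta>) / 2))"
proof -
  have "sin ((\<theta> - \<alpha>) / 2) * sin ((\<theta> - \<beta>) / 2) =
      (cos ((\<theta> - \<alpha>) / 2 - (\<theta> - \<beta>) / 2) - cos ((\<theta> - \<alpha>) / 2 + (\<theta> - \<beta>) / 2)) / 2"
    by (rule sin_times_sin)
  moreover have "(\<theta> - \<alpha>) / 2 - (\<theta> - \<beta>) / 2 = - ((\<alpha> - \<beta>) / 2)"
    "(\<theta> - \<alpha>) / 2 + (\<theta> - \<beta>) / 2 = \<theta> - (\<alpha> + \<beta>) / 2"
    by (simp_all add: field_simps)
  ultimately show ?thesis
    by simp
qed

text \<open>The argument equals pi * (k - i) / N, which lies strictly between -pi and pi and is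
  nonzero, so its sine has the sign of k - i.\<close>

lemma sin_half_pos_iff:
  fixes i k N :: nat
  assumes "i < N" "k < N" "i \<noteq> k"
  shows "0 < sin ((2 * pi * real k / real N - 2 * pi * real i / real N) / 2) \<longleftrightarrow> i < k"
    and "sin ((2 * pi * real k / real N - 2 * pi * real i / real N) / 2) < 0 \<longleftrightarrow> k < i"
proof -
  let ?x = "pi * ((real k - real i) / real N)"
  have eq: "(2 * pi * real k / real N - 2 * pi * real i / real N) / 2 = ?x"
    by (simp add: diff_divide_distrib right_diff_distrib)
  have gt: "0 < sin (pi * (y / real N))" if "0 < y" "y < real N" for y
  proof (rule sin_gt_zero)
    have "y / real N < 1"
      using that by simp
    then show "pi * (y / real N) < pi"
      using mult_strict_left_mono[OF _ pi_gt_zero, of "y / real N" 1] by simp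
  qed (use that in simp)
  have pos: "0 < sin ?x" if "i < k"
    using that assms by (intro gt) simp_all
  have neg: "sin ?x < 0" if "k < i"
  proof -
    have "0 < sin (pi * ((real i - real k) / real N))"
      using that assms by (intro gt) simp_all
    also have "pi * ((real i - real k) / real N) = - ?x"
      by (simp add: diff_divide_distrib right_diff_distrib)
    finally show ?thesis by simp
  qed
  from pos neg assms(3)
  show "0 < sin ((2 * pi * real k / real N - 2 * pi * real i / real N) / 2) \<longleftrightarrow> i < k"
    "sin ((2 * pi * real k / real N - 2 * pi * real i / real N) / 2) < 0 \<longleftrightarrow> k < i"
    unfolding eq by (cases "i < k"; force)+
qed

text \<open>The hypothesis on the order says that both or neither of \<open>k\<close>, \<open>l\<close> lie between \<open>i\<close> and
  \<open>j\<close>; then the line through the \<open>i\<close>-th and \<open>j\<close>-th points leaves the other two strictly on one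
  side.\<close>

lemma not_edges_cross_nth:
  fixes i j k l :: nat
  assumes "distinct \<omega>" and len: "i < length \<omega>" "j < length \<omega>" "k < length \<omega>" "l < length \<omega>"
    and ne: "k \<noteq> i" "k \<noteq> j" "l \<noteq> i" "l \<noteq> j"
    and sep: "((i < k) \<noteq> (j < k)) = ((i < l) \<noteq> (j < l))"
  shows "\<not> edges_cross \<omega> {\<omega> ! i, \<omega> ! j} {\<omega> ! k, \<omega> ! l}"
proof -
  let ?\<theta> = "\<lambda>x. 2 * pi * real x / real (length \<omega>)"
  \<comment> \<open>\<open>d\<close> and \<open>t\<close> are the normal and the offset of the line
    through the two points. Points at positions strictly between \<open>i\<close> and
    \<open>j\<close> satisfy d \<bullet> z > t, those at the other positions d \<bullet> z <
    t.\<close>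
  define d where "d = cis ((?\<theta> i + ?\<theta> j) / 2)"
  define t where "t = cos ((?\<theta> i - ?\<theta> j) / 2)"
  have inner_d: "d \<bullet> cis \<theta> = cos (\<theta> - (?\<theta> i + ?\<theta> j) / 2)" for \<theta>
    by (simp add: d_def inner_complex_def cos_diff mult.commute)
  have diff: "t - d \<bullet> cis (?\<theta> x) =
      2 * (sin ((?\<theta> x - ?\<theta> i) / 2) * sin ((?\<theta> x - ?\<theta> j) / 2))" for x
    unfolding t_def inner_d by (rule cos_diff_cos_half)
  have side: "if (i < x) \<noteq> (j < x) then t < d \<bullet> cis (?\<theta> x) else d \<bullet> cis (?\<theta> x) < t"
    if "x < length \<omega>" "x \<noteq> i" "x \<noteq> j" for x
  proof -
    note si = sin_half_pos_iff[OF len(1) that(1) that(2)[symmetric]]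
    note sj = sin_half_pos_iff[OF len(2) that(1) that(3)[symmetric]]
    have "t < d \<bullet> cis (?\<theta> x) \<longleftrightarrow>
        sin ((?\<theta> x - ?\<theta> i) / 2) * sin ((?\<theta> x - ?\<theta> j) / 2) < 0"
      using diff[of x] by linarith
    also have "\<dots> \<longleftrightarrow> (i < x) \<noteq> (j < x)"
      unfolding mult_less_0_iff si sj using that by linarith
    finally have 1: "t < d \<bullet> cis (?\<theta> x) \<longleftrightarrow> (i < x) \<noteq> (j < x)" .
    have "d \<bullet> cis (?\<theta> x) < t \<longleftrightarrow>
        0 < sin ((?\<theta> x - ?\<theta> i) / 2) * sin ((?\<theta> x - ?\<theta> j) / 2)"
      using diff[of x] by linarith
    also have "\<dots> \<longleftrightarrow> (i < x) = (j < x)"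
      unfolding zero_less_mult_iff si sj using that by linarith
    finally show ?thesis
      using 1 by simp
  qed
  have "d \<bullet> cis (?\<theta> i) = t" "d \<bullet> cis (?\<theta> j) = t"
    using diff[of i] diff[of j] by simp_all
  then have on: "chord \<omega> {\<omega> ! i, \<omega> ! j} \<subseteq> {z. d \<bullet> z = t}"
    unfolding chord_def using assms(1) len
    by (intro hull_minimal convex_hyperplane) (simp add: circle_point_nth)
  have "chord \<omega> {\<omega> ! k, \<omega> ! l} \<subseteq> {z. d \<bullet> z < t} \<or> chord \<omega> {\<omega> ! k, \<omega> ! l} \<subseteq> {z. d \<bullet> z > t}"
  proof (cases "(i < k) \<noteq> (j < k)")
    case True
    then have "t < d \<bullet> cis (?\<theta> k)" "t < d \<bullet> cis (?\<theta> l)"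
      using side[of k] side[of l] sep len ne by (simp_all split: if_splits)
    then have "chord \<omega> {\<omega> ! k, \<omega> ! l} \<subseteq> {z. d \<bullet> z > t}"
      unfolding chord_def using assms(1) len
      by (intro hull_minimal convex_halfspace_gt) (simp add: circle_point_nth)
    then show ?thesis ..
  next
    case False
    then have "d \<bullet> cis (?\<theta> k) < t" "d \<bullet> cis (?\<theta> l) < t"
      using side[of k] side[of l] sep len ne by (simp_all split: if_splits)
    then have "chord \<omega> {\<omega> ! k, \<omega> ! l} \<subseteq> {z. d \<bullet> z < t}"
      unfolding chord_def using assms(1) len
      by (intro hull_minimal convex_halfspace_lt) (simp add: circle_point_nth)
    then show ?thesis ..
  qed
  with on have "chord \<omega> {\<omega> ! i, \<omega> ! j} \<inter> chord \<omega> {\<omega> ! k, \<omega> ! l} = {}"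
    by fastforce
  then show ?thesis
    by (simp add: edges_cross_def)
qed

section \<open>Positions of the vertices in the odd-even order\<close>

lemma filter_odd_upt: "filter odd [1..<2 * m + 2] = map (\<lambda>i. 2 * i + 1) [0..<m + 1]"
  by (induction m) (simp_all add: upt_rec[of 1])

lemma filter_even_upt: "filter even [1..<2 * m + 2] = map (\<lambda>i. 2 * i + 2) [0..<m]"
  by (induction m) (simp_all add: upt_rec[of 1])

lemma odd_even_order_odd:
  "odd_even_order (2 * m + 1) =
    map (\<lambda>i. 2 * i + 1) [0..<m + 1] @ rev (map (\<lambda>i. 2 * i + 2) [0..<m])"
  using filter_odd_upt[of m] filter_even_upt[of m] by (simp add: odd_even_order_def)

text \<open>Positions count from 0. The even numbers fill the end of the list backwards: 2 is at the
  last position n - 1, and 2 * h at n - h.\<close>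

definition odd_even_index :: "nat \<Rightarrow> nat \<Rightarrow> nat" where
  "odd_even_index n v = (if odd v then v div 2 else n - v div 2)"

lemma length_odd_even_order: "odd n \<Longrightarrow> length (odd_even_order n) = n"
  by (elim oddE) (simp only: odd_even_order_odd, simp)

lemma distinct_odd_even_order: "distinct (odd_even_order n)"
  using cyclic_order_on_odd_even_order[of n "{}"] by (simp add: cyclic_order_on_def)

lemma odd_even_index_less:
  assumes "v \<in> {1..n}"
  shows "odd_even_index n v < n"
  using assms by (auto simp: odd_even_index_def elim!: evenE)

lemma nth_odd_even_index:
  assumes "odd n" "v \<in> {1..n}"
  shows "odd_even_order n ! odd_even_index n v = v"
proof -
  obtain m where m: "n = 2 * m + 1"
    using assms(1) by (elim oddE)
  show ?thesis
  proof (cases "odd v")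
    case True
    then obtain i where "v = 2 * i + 1"
      by (elim oddE)
    then show ?thesis
      using assms(2) m unfolding m odd_even_order_odd
      by (simp add: odd_even_index_def nth_append del: upt_Suc)
  next
    case False
    then obtain i where "v = 2 * i"
      by (auto elim: evenE)
    then show ?thesis
      using assms(2) m unfolding m odd_even_order_odd
      by (auto simp: odd_even_index_def nth_append rev_nth simp del: upt_Suc)
  qed
qed

lemma odd_even_index_eq_iff:
  assumes "odd n" "u \<in> {1..n}" "v \<in> {1..n}"
  shows "odd_even_index n u = odd_even_index n v \<longleftrightarrow> u = v"
  using nth_odd_even_index[OF assms(1,2)] nth_odd_even_index[OF assms(1,3)] by metis

lemma not_edges_cross_odd_even_order:
  assumes "odd n" "u \<in> {1..n}" "v \<in> {1..n}" "x \<in> {1..n}" "y \<in> {1..n}"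
    and "{u, v} \<inter> {x, y} = {}"
    and "((odd_even_index n u < odd_even_index n x) \<noteq> (odd_even_index n v < odd_even_index n x)) =
      ((odd_even_index n u < odd_even_index n y) \<noteq> (odd_even_index n v < odd_even_index n y))"
  shows "\<not> edges_cross (odd_even_order n) {u, v} {x, y}"
proof -
  note nth = nth_odd_even_index[OF assms(1)]
  have "\<not> edges_cross (odd_even_order n)
      {odd_even_order n ! odd_even_index n u, odd_even_order n ! odd_even_index n v}
      {odd_even_order n ! odd_even_index n x, odd_even_order n ! odd_even_index n y}"
  proof (rule not_edges_cross_nth)
    show "odd_even_index n x \<noteq> odd_even_index n u" "odd_even_index n x \<noteq> odd_even_index n v"
      "odd_even_index n y \<noteq> odd_even_index n u" "odd_even_index n y \<noteq> odd_even_index n v"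
      using assms(2-6) odd_even_index_eq_iff[OF assms(1)] by blast+
  qed (use assms in \<open>simp_all only: distinct_odd_even_order length_odd_even_order[OF assms(1)] odd_even_index_less\<close>)
  then show ?thesis
    unfolding nth[OF assms(2)] nth[OF assms(3)] nth[OF assms(4)] nth[OF assms(5)] .
qed

lemma edges_cross_commute: "edges_cross \<omega> e f \<longleftrightarrow> edges_cross \<omega> f e"
  by (auto simp: edges_cross_def)

section \<open>The edges as increasing pairs\<close>

text \<open>Requiring a < b gives every edge exactly one pair, which serves both the counting and
  the page assignment. The last two alternatives are the edges that wrap around modulo n.\<close>

definition circulant_23_edge :: "nat \<Rightarrow> nat \<Rightarrow> nat \<Rightarrow> bool" where
  "circulant_23_edge n a b \<longleftrightarrow>
    1 \<le> a \<and> a < b \<and> b \<le> n \<and> (b = a + 2 \<or> b = a + 3 \<or> b + 2 = a + n \<or> b + 3 = a + n)"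

text \<open>Since j + i - k lies strictly between -n and 2 * n, the only multiples of n it can equal
  are 0 and n.\<close>

lemma cong_add_small_iff:
  fixes j k i n :: nat
  assumes "j \<in> {1..n}" "k \<in> {1..n}" "i < n"
  shows "[k = j + i] (mod n) \<longleftrightarrow> k = j + i \<or> k + n = j + i"
proof
  assume "[k = j + i] (mod n)"
  then consider q where "k = q * n + (j + i)" | q where "j + i = q * n + k"
    using cong_le_nat[of "j + i" k n] cong_le_nat[of k "j + i" n] cong_sym_eq[of k "j + i" n]
      nat_le_linear[of k "j + i"] by blast
  then show "k = j + i \<or> k + n = j + i"
  proof cases
    case 1
    then show ?thesis
      using assms by (cases q) auto
  next
    case 2
    then show ?thesis
      using assms by (cases q; cases "q - 1") auto
  qed
next
  assume "k = j + i \<or> k + n = j + i"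
  then show "[k = j + i] (mod n)"
    by (auto simp: cong_def dest: arg_cong[of "k + n" _ "\<lambda>x. x mod n"])
qed

lemma edges_circulant_23:
  assumes "n \<ge> 7"
  shows "edges (circulant n {2, 3}) = {{a, b} | a b. circulant_23_edge n a b}"
proof -
  have "(\<exists>i\<in>{2, 3}. [k = j + i] (mod n)) \<longleftrightarrow>
      (k = j + 2 \<or> k + n = j + 2 \<or> k = j + 3 \<or> k + n = j + 3)"
    if "j \<in> {1..n}" "k \<in> {1..n}" for j k
    using cong_add_small_iff[OF that, of 2] cong_add_small_iff[OF that, of 3] assms by simp
  then have "edges (circulant n {2, 3}) = {{j, k} | j k. j \<in> {1..n} \<and> k \<in> {1..n} \<and>
      (k = j + 2 \<or> k + n = j + 2 \<or> k = j + 3 \<or> k + n = j + 3)}"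
    unfolding circulant_def by (simp cong: conj_cong)
  also have "\<dots> = {{a, b} | a b. circulant_23_edge n a b}"
  proof (intro equalityI subsetI; clarify)
    fix j k assume *: "j \<in> {1..n}" "k \<in> {1..n}"
      "k = j + 2 \<or> k + n = j + 2 \<or> k = j + 3 \<or> k + n = j + 3"
    then have "circulant_23_edge n j k \<or> circulant_23_edge n k j"
      using assms by (elim disjE) (simp_all add: circulant_23_edge_def)
    then show "\<exists>a b. {j, k} = {a, b} \<and> circulant_23_edge n a b"
      by (metis insert_commute)
  next
    fix a b assume *: "circulant_23_edge n a b"
    then have range: "a \<in> {1..n}" "b \<in> {1..n}"
      and "(b = a + 2 \<or> b + n = a + 2 \<or> b = a + 3 \<or> b + n = a + 3) \<or>
        (a = b + 2 \<or> a + n = b + 2 \<or> a = b + 3 \<or> a + n = b + 3)"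
      by (auto simp: circulant_23_edge_def)
    from this(3) show "\<exists>j k. {a, b} = {j, k} \<and> j \<in> {1..n} \<and> k \<in> {1..n} \<and>
      (k = j + 2 \<or> k + n = j + 2 \<or> k = j + 3 \<or> k + n = j + 3)"
    proof
      assume "a = b + 2 \<or> a + n = b + 2 \<or> a = b + 3 \<or> a + n = b + 3"
      with range show ?thesis
        by (subst insert_commute) blast
    qed (use range in blast)
  qed
  finally show ?thesis .
qed

lemma circulant_23_edge_iff:
  assumes "n \<ge> 7"
  shows "circulant_23_edge n a b \<longleftrightarrow>
    b = a + 2 \<and> 1 \<le> a \<and> a \<le> n - 2 \<or> b = a + 3 \<and> 1 \<le> a \<and> a \<le> n - 3 \<or>
    a = 1 \<and> b = n - 1 \<or> a = 2 \<and> b = n \<or> a = 1 \<and> b = n - 2 \<or> a = 2 \<and> b = n - 1 \<or> a = 3 \<and> b = n"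
    (is "_ \<longleftrightarrow> ?rhs")
proof
  assume "circulant_23_edge n a b"
  then have r: "1 \<le> a" "a < b" "b \<le> n"
    and "b = a + 2 \<or> b = a + 3 \<or> b + 2 = a + n \<or> b + 3 = a + n"
    by (simp_all add: circulant_23_edge_def)
  moreover have "a \<le> n - 2" if "b = a + 2"
    using r that by linarith
  moreover have "a \<le> n - 3" if "b = a + 3"
    using r that by linarith
  moreover have "a = 1 \<and> b = n - 1 \<or> a = 2 \<and> b = n" if "b + 2 = a + n"
    using r that by linarith
  moreover have "a = 1 \<and> b = n - 2 \<or> a = 2 \<and> b = n - 1 \<or> a = 3 \<and> b = n" if "b + 3 = a + n"
    using r that by linarith
  ultimately show ?rhs
    by blast
next
  assume ?rhs
  then show "circulant_23_edge n a b"
    unfolding circulant_23_edge_def using assms by (elim disjE) auto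
qed

section \<open>The assignment of edges to pages, and disjointness within a page\<close>

text \<open>\<open>side_page n p a\<close> puts the side \<open>{a, a + 2}\<close> on page \<open>p\<close>. Which of the alternatives for page 2
  occurs depends on \<open>n mod 4\<close>.\<close>

definition side_page :: "nat \<Rightarrow> nat \<Rightarrow> nat \<Rightarrow> bool" where
  "side_page n p a \<longleftrightarrow>
    p = 0 \<and> (a mod 4 = 1 \<and> 5 \<le> a \<and> a + 4 \<le> n \<or> a mod 4 = 2 \<and> a + 5 \<le> n) \<or>
    p = 1 \<and> (a mod 4 = 3 \<and> a + 6 \<le> n \<or> a mod 4 = 0 \<and> a + 5 \<noteq> n \<or> a + 3 = n) \<or>
    p = 2 \<and> (a mod 4 = 3 \<and> a + 4 = n \<or> a mod 4 = 0 \<and> a + 5 = n) \<or>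
    p = 3 \<and> a + 2 = n \<or>
    p = 4 \<and> a = 1"

definition wrap_page :: "nat \<Rightarrow> nat \<Rightarrow> nat \<Rightarrow> nat \<Rightarrow> bool" where
  "wrap_page n p a b \<longleftrightarrow>
    p = 0 \<and> (a = 1 \<and> b = n - 1 \<or> a = 3 \<and> b = n) \<or>
    p = 1 \<and> (a = 1 \<and> b = n - 2 \<or> a = 2 \<and> b = n) \<or>
    p = 2 \<and> a = 2 \<and> b = n - 1"

text \<open>A relation rather than a function: that every edge has a page and that edges on a common
  page are compatible are shown separately, and a colouring is chosen from it at the end.\<close>

definition on_page :: "nat \<Rightarrow> nat \<Rightarrow> nat \<Rightarrow> nat \<Rightarrow> bool" where
  "on_page n p a b \<longleftrightarrow>
    b = a + 2 \<and> side_page n p a \<or> b = a + 3 \<and> p = (if odd a then 3 else 4) \<or> wrap_page n p a b"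

lemma on_page_less: "on_page n p a b \<Longrightarrow> p < 5"
  by (auto simp: on_page_def side_page_def wrap_page_def)

lemma side_page_exists:
  assumes "odd n" "a + 2 \<le> n"
  shows "\<exists>p. side_page n p a"
proof (cases "odd a")
  case True
  \<comment> \<open>The difference n - a is even here, so the exceptional sides near n are exactly
    those at distance 2 and 4.\<close>
  have "a + 2 = n \<or> a + 4 = n \<or> a + 6 \<le> n"
    using True assms by presburger
  moreover have "a mod 4 = 1 \<and> (a = 1 \<or> 5 \<le> a) \<or> a mod 4 = 3"
    using True by presburger
  ultimately consider "a = 1" | "a + 2 = n" | "a mod 4 = 1 \<and> 5 \<le> a \<and> a + 4 \<le> n" |
    "a mod 4 = 3 \<and> a + 4 = n" | "a mod 4 = 3 \<and> a + 6 \<le> n"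
    by linarith
  then have "side_page n 4 a \<or> side_page n 3 a \<or> side_page n 0 a \<or> side_page n 2 a \<or> side_page n 1 a"
    by cases (simp_all add: side_page_def)
  then show ?thesis by blast
next
  case False
  have "a + 3 = n \<or> a + 5 \<le> n"
    using False assms by presburger
  moreover have "a mod 4 = 2 \<or> a mod 4 = 0"
    using False by presburger
  ultimately consider "a + 3 = n" | "a mod 4 = 2 \<and> a + 5 \<le> n" |
    "a mod 4 = 0 \<and> a + 5 = n" | "a mod 4 = 0 \<and> a + 5 \<noteq> n"
    by linarith
  then have "side_page n 1 a \<or> side_page n 0 a \<or> side_page n 2 a"
    by cases (simp_all add: side_page_def)
  then show ?thesis by blast
qed

lemma on_page_exists:
  assumes "odd n" "7 \<le> n" "circulant_23_edge n a b"
  shows "\<exists>p. on_page n p a b"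
proof -
  consider "b = a + 2" "a \<le> n - 2" | "b = a + 3" | "a = 1 \<and> b = n - 1 \<or> a = 2 \<and> b = n" |
    "a = 1 \<and> b = n - 2 \<or> a = 2 \<and> b = n - 1 \<or> a = 3 \<and> b = n"
    using assms(3) unfolding circulant_23_edge_iff[OF assms(2)] by blast
  then show ?thesis
  proof cases
    case 1
    then have "a + 2 \<le> n"
      using assms(2) by linarith
    then obtain p where "side_page n p a"
      using side_page_exists[OF assms(1)] by blast
    then have "on_page n p a b"
      using 1 by (simp add: on_page_def)
    then show ?thesis by blast
  next
    case 2
    then have "on_page n (if odd a then 3 else 4) a b"
      by (simp add: on_page_def)
    then show ?thesis by blast
  next
    case 3
    then have "wrap_page n 0 a b \<or> wrap_page n 1 a b"
      by (auto simp: wrap_page_def)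
    then show ?thesis by (auto simp: on_page_def)
  next
    case 4
    then have "wrap_page n 1 a b \<or> wrap_page n 2 a b \<or> wrap_page n 0 a b"
      by (auto simp: wrap_page_def)
    then show ?thesis by (auto simp: on_page_def)
  qed
qed

text \<open>Adding 2 exchanges the residues 1 and 3, and 2 and 0, modulo 4, hence pages 0 and 1. The
  exception is the last even side, a = n - 3, which is always on page 1; if n - 5 is divisible by 4,
  the side before it would also be there and is moved to page 2.\<close>

lemma side_page_consecutive:
  assumes "odd n" "a + 4 \<le> n" "side_page n p a"
  shows "\<not> side_page n p (a + 2)"
proof -
  have "a mod 4 = 0 \<or> a mod 4 = 1 \<or> a mod 4 = 2 \<or> a mod 4 = 3"
    by linarith
  moreover have "a mod 4 = 0 \<Longrightarrow> even a \<and> (a + 2) mod 4 = 2"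
    "a mod 4 = 1 \<Longrightarrow> odd a \<and> (a + 2) mod 4 = 3"
    "a mod 4 = 2 \<Longrightarrow> even a \<and> (a + 2) mod 4 = 0"
    "a mod 4 = 3 \<Longrightarrow> odd a \<and> (a + 2) mod 4 = 1"
    by presburger+
  ultimately show ?thesis
    using assms by (elim disjE; auto simp: side_page_def)
qed

text \<open>On page 3 the odd endpoints of the diagonals are at most n - 4 and so avoid {n - 2, n};
  on page 4 they are at least 5 and so avoid {1, 3}.\<close>

lemma side_page_diagonal:
  assumes "odd n" "7 \<le> n" "side_page n p a" "p = (if odd a' then 3 else 4)" "1 \<le> a'" "a' + 3 \<le> n"
  shows "{a, a + 2} \<inter> {a', a' + 3} = {}"
  using assms by (auto simp: side_page_def split: if_splits)

text \<open>This is where the exceptions in \<open>side_page\<close> are needed. Both {1, 3} and {n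
  - 2, n} meet wrapping edges on each of pages 0 and 1; {n - 3, n - 1} meets {1, n - 1} and must
  avoid page 0; {n - 4, n - 2} meets {1, n - 2} and must avoid page 1.\<close>

lemma side_page_wrap:
  assumes "odd n" "7 \<le> n" "1 \<le> a" "side_page n p a" "wrap_page n p a' b'"
  shows "{a, a + 2} \<inter> {a', b'} = {}"
proof -
  have parity: "even a \<longleftrightarrow> a mod 4 = 0 \<or> a mod 4 = 2" "a mod 4 = 0 \<longrightarrow> 4 \<le> a" "a mod 4 = 3 \<longrightarrow> 3 \<le> a"
    using assms(3) by presburger+
  have n: "a + 2 \<noteq> n \<and> a + 4 \<noteq> n \<and> a \<noteq> n" if "even a"
    using that assms(1) by auto
  consider "p = 0" "a' = 1 \<and> b' = n - 1 \<or> a' = 3 \<and> b' = n" |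
    "p = 1" "a' = 1 \<and> b' = n - 2 \<or> a' = 2 \<and> b' = n" |
    "p = 2" "a' = 2" "b' = n - 1"
    using assms(5) unfolding wrap_page_def by blast
  then show ?thesis
  proof cases
    case 1
    then have "odd a \<and> 5 \<le> a \<and> a + 4 \<le> n \<or> even a \<and> a + 5 \<le> n"
      using assms(4) parity(1) by (auto simp: side_page_def)
    then show ?thesis
      using 1(2) assms(2) by (elim disjE conjE; auto)
  next
    case 2
    then have "3 \<le> a \<and> a + 6 \<le> n \<or> even a \<and> 4 \<le> a"
    proof -
      have "a mod 4 = 3 \<and> a + 6 \<le> n \<or> a mod 4 = 0 \<or> a + 3 = n"
        using assms(4) 2(1) unfolding side_page_def by fastforce
      moreover have "even a" if "a + 3 = n"
        using that assms(1) by auto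
      ultimately show ?thesis
        using parity assms(2) by (elim disjE; simp)
    qed
    then show ?thesis
      using 2(2) assms(2) n by (elim disjE conjE; auto)
  next
    case 3
    then have "3 \<le> a \<and> a + 4 \<le> n"
      using assms(4) parity by (auto simp: side_page_def)
    then show ?thesis
      using 3(2,3) by auto
  qed
qed

lemma wrap_page_disjoint:
  assumes "7 \<le> n" "wrap_page n p a b" "wrap_page n p a' b'" "(a, b) \<noteq> (a', b')"
  shows "{a, b} \<inter> {a', b'} = {}"
  using assms unfolding wrap_page_def by (elim disjE conjE; simp)

section \<open>Absence of crossings within a page\<close>

lemma side_not_edges_cross:
  assumes "odd n" "1 \<le> a" "a + 2 \<le> n" "x \<in> {1..n}" "y \<in> {1..n}" "{a, a + 2} \<inter> {x, y} = {}"
  shows "\<not> edges_cross (odd_even_order n) {a, a + 2} {x, y}"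
proof -
  let ?i = "odd_even_index n"
  have range: "a \<in> {1..n}" "a + 2 \<in> {1..n}"
    using assms by auto
  have "?i z \<noteq> ?i a \<and> ?i z \<noteq> ?i (a + 2)" if "z \<in> {x, y}" for z
    using assms(4-6) that odd_even_index_eq_iff[OF assms(1)] range by blast
  \<comment> \<open>The two ends occupy neighbouring positions, so no third position separates
    them.\<close>
  moreover have "?i (a + 2) = ?i a + 1 \<or> ?i a = ?i (a + 2) + 1"
    using assms(3) by (auto simp: odd_even_index_def)
  ultimately have "(?i a < ?i z) = (?i (a + 2) < ?i z)" if "z \<in> {x, y}" for z
    using that by fastforce
  then show ?thesis
    by (intro not_edges_cross_odd_even_order assms range) simp
qed

text \<open>The positions of the two ends sum to n - 2 for odd \<open>a\<close> and to n + 1 for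
  even \<open>a\<close>. Intervals of positions with the same midpoint are nested, so the chords do
  not cross.\<close>

lemma diagonals_not_edges_cross:
  assumes "odd n" "1 \<le> a" "a + 3 \<le> n" "1 \<le> a'" "a' + 3 \<le> n" "a \<noteq> a'" "odd a = odd a'"
  shows "\<not> edges_cross (odd_even_order n) {a, a + 3} {a', a' + 3}"
proof (rule not_edges_cross_odd_even_order)
  show "{a, a + 3} \<inter> {a', a' + 3} = {}"
    using assms(6,7) by auto
  let ?i = "odd_even_index n"
  show "((?i a < ?i a') \<noteq> (?i (a + 3) < ?i a')) = ((?i a < ?i (a' + 3)) \<noteq> (?i (a + 3) < ?i (a' + 3)))"
  proof (cases "odd a")
    case True
    then obtain i j where "a = 2 * i + 1" "a' = 2 * j + 1"
      using assms(7) by (metis oddE)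
    moreover from this have "?i a = i" "?i (a + 3) = n - (i + 2)" "?i a' = j" "?i (a' + 3) = n - (j + 2)"
      by (simp_all add: odd_even_index_def)
    ultimately show ?thesis
      using assms(3,5,6) by linarith
  next
    case False
    then obtain i j where "a = 2 * i" "a' = 2 * j"
      using assms(7) by (metis evenE)
    moreover from this have "?i a = n - i" "?i (a + 3) = i + 1" "?i a' = n - j" "?i (a' + 3) = j + 1"
      by (simp_all add: odd_even_index_def)
    ultimately show ?thesis
      using assms(3,5,6) by linarith
  qed
qed (use assms in auto)

lemma wraps_not_edges_cross:
  assumes "odd n" "7 \<le> n"
  shows "\<not> edges_cross (odd_even_order n) {1, n - 1} {3, n}"
    and "\<not> edges_cross (odd_even_order n) {1, n - 2} {2, n}"
proof -
  obtain m where m: "n = 2 * m + 1"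
    using assms(1) by (elim oddE)
  have index: "odd_even_index n 1 = 0" "odd_even_index n 3 = 1" "odd_even_index n 2 = n - 1"
    "odd_even_index n n = m" "odd_even_index n (n - 1) = m + 1"
    using m by (simp_all add: odd_even_index_def)
  have "n - 2 = 2 * (m - 1) + 1"
    using m assms(2) by simp
  then have index': "odd_even_index n (n - 2) = m - 1"
    by (simp add: odd_even_index_def)
  \<comment> \<open>With n = 2 * m + 1 the positions are 0, m + 1 and 1, m, which are nested; in the
    second claim they are 0, m - 1 and m, n - 1, which are side by side.\<close>
  show "\<not> edges_cross (odd_even_order n) {1, n - 1} {3, n}"
    by (rule not_edges_cross_odd_even_order) (unfold index, use assms m in auto)
  show "\<not> edges_cross (odd_even_order n) {1, n - 2} {2, n}"
    by (rule not_edges_cross_odd_even_order) (unfold index index', use assms m in auto)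
qed

lemma on_page_compatible:
  assumes n: "odd n" "7 \<le> n" and e: "circulant_23_edge n a b" and f: "circulant_23_edge n a' b'"
    and p: "on_page n p a b" "on_page n p a' b'" and ne: "(a, b) \<noteq> (a', b')"
  shows "{a, b} \<inter> {a', b'} = {} \<and> \<not> edges_cross (odd_even_order n) {a, b} {a', b'}"
proof -
  \<comment> \<open>Stated for arbitrary pairs so that it also applies with the two edges
    exchanged.\<close>
  have side: "{a, b} \<inter> {a', b'} = {} \<and> \<not> edges_cross (odd_even_order n) {a, b} {a', b'}"
    if e: "circulant_23_edge n a b" and f: "circulant_23_edge n a' b'" and b: "b = a + 2"
      and a: "side_page n p a" and p': "on_page n p a' b'" and ne: "(a, b) \<noteq> (a', b')"
    for a b a' b'
  proof -
    have r: "1 \<le> a" "a + 2 \<le> n" "1 \<le> a'" "a' < b'" "b' \<le> n"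
      using e f b by (simp_all add: circulant_23_edge_def)
    consider "b' = a' + 2" "side_page n p a'" | "b' = a' + 3" "p = (if odd a' then 3 else 4)" |
      "wrap_page n p a' b'"
      using p' unfolding on_page_def by blast
    then have "{a, b} \<inter> {a', b'} = {}"
    proof cases
      case 1
      then have "a \<noteq> a' + 2" "a' \<noteq> a + 2" "a \<noteq> a'"
        using side_page_consecutive[OF n(1)] r ne b a by auto
      then show ?thesis
        using 1 b by auto
    next
      case 2
      then show ?thesis
        using side_page_diagonal[OF n a 2(2)] r b by simp
    next
      case 3
      then show ?thesis
        using side_page_wrap[OF n r(1) a 3] b by simp
    qed
    then show ?thesis
      using side_not_edges_cross[OF n(1) r(1,2)] r b by simp
  qed
  have r: "1 \<le> a" "b \<le> n" "1 \<le> a'" "b' \<le> n"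
    using e f by (simp_all add: circulant_23_edge_def)
  have swap: ?thesis
    if "{a', b'} \<inter> {a, b} = {} \<and> \<not> edges_cross (odd_even_order n) {a', b'} {a, b}"
    using that by (subst edges_cross_commute) blast
  have wrap_lt: "p < 3" if "wrap_page n p x y" for x y
    using that by (auto simp: wrap_page_def)
  have diagonal_ge: "3 \<le> p" if "p = (if odd x then 3 else 4)" for x :: nat
    using that by simp
  \<comment> \<open>Wrapping edges use pages below 3 and diagonals pages 3 and 4, so a mixed pair
    falls under the contradictory last case.\<close>
  consider "b = a + 2" "side_page n p a" | "b' = a' + 2" "side_page n p a'" |
    "b = a + 3" "p = (if odd a then 3 else 4)" "b' = a' + 3" "p = (if odd a' then 3 else 4)" |
    "wrap_page n p a b" "wrap_page n p a' b'" |
    "3 \<le> p" "p < 3"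
    using p wrap_lt diagonal_ge unfolding on_page_def by blast
  then show ?thesis
  proof cases
    case 1
    then show ?thesis
      using side[OF e f] p ne by blast
  next
    case 2
    then show ?thesis
      using side[OF f e] p ne swap by blast
  next
    case 3
    then have "odd a = odd a'" "a \<noteq> a'"
      using ne by (auto split: if_splits)
    then show ?thesis
      using diagonals_not_edges_cross[OF n(1), of a a'] r 3 by auto
  next
    case 4
    have "(a, b) = (1, n - 1) \<and> (a', b') = (3, n) \<or> (a', b') = (1, n - 1) \<and> (a, b) = (3, n) \<or>
      (a, b) = (1, n - 2) \<and> (a', b') = (2, n) \<or> (a', b') = (1, n - 2) \<and> (a, b) = (2, n)"
      using 4 ne unfolding wrap_page_def by (elim disjE conjE; simp)
    then have "\<not> edges_cross (odd_even_order n) {a, b} {a', b'}"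
      using wraps_not_edges_cross[OF n] edges_cross_commute by (elim disjE conjE) auto
    then show ?thesis
      using wrap_page_disjoint[OF n(2) 4 ne] by blast
  qed simp
qed

section \<open>Counting edges and the lower bound on the number of pages\<close>

lemma card_pairwise_disjoint_pairs:
  assumes "finite V" "\<And>e. e \<in> M \<Longrightarrow> e \<subseteq> V \<and> card e = 2" "pairwise disjnt M"
  shows "card M \<le> card V div 2"
proof -
  have "card (\<Union>M) = sum card M"
    using assms by (intro card_Union_disjoint) (auto intro: finite_subset)
  also have "\<dots> = 2 * card M"
    using assms(2) by simp
  finally have "2 * card M \<le> card V"
    using card_mono[OF assms(1), of "\<Union>M"] assms(2) by auto
  then show ?thesis
    by simp
qed

lemma card_edges_le_num_pages:
  assumes "matching_book_embedding G \<omega> c"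
  shows "card (edges G) \<le> num_pages G c * (card (verts G) div 2)"
proof -
  have G: "finite (verts G)" "\<And>e. e \<in> edges G \<Longrightarrow> e \<subseteq> verts G \<and> card e = 2"
    using assms by (auto simp: matching_book_embedding_def simple_graph_def)
  then have fin: "finite (edges G)"
    by (meson Pow_iff finite_Pow_iff finite_subset subsetI)
  have "card (edges G) = (\<Sum>p\<in>c ` edges G. card {e \<in> edges G. c e = p})"
    using sum.image_gen[OF fin, of "\<lambda>_. 1::nat" c] by simp
  also have "\<dots> \<le> (\<Sum>p\<in>c ` edges G. card (verts G) div 2)"
  proof (rule sum_mono, rule card_pairwise_disjoint_pairs)
    fix p
    show "pairwise disjnt {e \<in> edges G. c e = p}"
      using assms by (auto simp: pairwise_def disjnt_def matching_book_embedding_def)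
  qed (use G in auto)
  finally show ?thesis
    by (simp add: num_pages_def)
qed

lemma card_edges_circulant_23:
  assumes "n \<ge> 7"
  shows "card (edges (circulant n {2, 3})) = 2 * n"
proof -
  define P where "P = {(a, b). circulant_23_edge n a b}"
  have "edges (circulant n {2, 3}) = (\<lambda>(a, b). {a, b}) ` P"
    using assms by (auto simp: edges_circulant_23 P_def)
  moreover have "inj_on (\<lambda>(a, b). {a, b}) P"
    by (auto simp: inj_on_def P_def circulant_23_edge_def doubleton_eq_iff)
  ultimately have "card (edges (circulant n {2, 3})) = card P"
    by (simp add: card_image)
  \<comment> \<open>The five remaining pairs have difference n - 2 or n - 3, at least 4, so the
    three families are disjoint and contribute (n - 2) + (n - 3) + 5.\<close>
  also have "P = (\<lambda>a. (a, a + 2)) ` {1..n - 2} \<union> ((\<lambda>a. (a, a + 3)) ` {1..n - 3} \<union>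
      {(1, n - 1), (2, n), (1, n - 2), (2, n - 1), (3, n)})" (is "_ = ?A \<union> (?B \<union> ?C)")
  proof -
    have "P = {(a, b). b = a + 2 \<and> a \<in> {1..n - 2}} \<union> ({(a, b). b = a + 3 \<and> a \<in> {1..n - 3}} \<union> ?C)"
    proof (rule set_eqI)
      fix x :: "nat \<times> nat"
      obtain a b where "x = (a, b)"
        by fastforce
      then show "x \<in> P \<longleftrightarrow> x \<in> {(a, b). b = a + 2 \<and> a \<in> {1..n - 2}} \<union>
          ({(a, b). b = a + 3 \<and> a \<in> {1..n - 3}} \<union> ?C)"
        by (simp only: P_def circulant_23_edge_iff[OF assms] mem_Collect_eq prod.case Un_iff
            insert_iff atLeastAtMost_iff prod.inject empty_iff) blast
    qed
    also have "{(a, b). b = a + 2 \<and> a \<in> {1..n - 2}} = ?A"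
      by auto
    also have "{(a, b). b = a + 3 \<and> a \<in> {1..n - 3}} = ?B"
      by auto
    finally show ?thesis .
  qed
  also have "card \<dots> = card ?A + (card ?B + card ?C)"
    using assms by (subst card_Un_disjoint; (subst card_Un_disjoint)?; auto)
  also have "card ?A = n - 2"
    by (subst card_image) (simp_all add: inj_on_def)
  also have "card ?B = n - 3"
    by (subst card_image) (simp_all add: inj_on_def)
  also have "card ?C = 5"
    using assms by simp
  finally show ?thesis
    using assms by simp
qed

lemma max_degree_circulant_23:
  assumes "n \<ge> 7"
  shows "max_degree (circulant n {2, 3}) = 4"
proof -
  let ?G = "circulant n {2, 3}"
  have verts: "verts ?G = {1..n}"
    by (simp add: circulant_def)
  have card_le_4: "card {w, x, y, z} \<le> 4" for w x y z :: nat
    by (simp add: card_insert_if)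
  have deg_le: "degree ?G v \<le> 4" for v
  proof -
    \<comment> \<open>These are v + 2, v + 3, v - 2 and v - 3 reduced modulo n to the range from 1
      to n.\<close>
    let ?N = "{if v + 2 \<le> n then v + 2 else v + 2 - n, if v + 3 \<le> n then v + 3 else v + 3 - n,
      if 2 < v then v - 2 else v + n - 2, if 3 < v then v - 3 else v + n - 3}"
    have "u \<in> ?N" if "circulant_23_edge n u v \<or> circulant_23_edge n v u" for u
    proof -
      have r: "1 \<le> u" "u \<le> n" "1 \<le> v" "v \<le> n"
        using that by (auto simp: circulant_23_edge_def)
      have "(u = v + 2 \<or> u + n = v + 2) \<or> (u = v + 3 \<or> u + n = v + 3) \<or>
          (v = u + 2 \<or> v + n = u + 2) \<or> (v = u + 3 \<or> v + n = u + 3)"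
        using that unfolding circulant_23_edge_def by metis
      moreover have "u = (if v + 2 \<le> n then v + 2 else v + 2 - n)" if "u = v + 2 \<or> u + n = v + 2"
        using that r by auto
      moreover have "u = (if v + 3 \<le> n then v + 3 else v + 3 - n)" if "u = v + 3 \<or> u + n = v + 3"
        using that r by auto
      moreover have "u = (if 2 < v then v - 2 else v + n - 2)" if "v = u + 2 \<or> v + n = u + 2"
        using that r by auto
      moreover have "u = (if 3 < v then v - 3 else v + n - 3)" if "v = u + 3 \<or> v + n = u + 3"
        using that r by auto
      ultimately show ?thesis
        by blast
    qed
    then have "{e \<in> edges ?G. v \<in> e} \<subseteq> (\<lambda>u. {v, u}) ` ?N"
      unfolding edges_circulant_23[OF assms] by blast
    then have "degree ?G v \<le> card ?N"
      unfolding degree_def by (rule surj_card_le[rotated]) simp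
    also have "\<dots> \<le> 4"
      by (rule card_le_4)
    finally show ?thesis .
  qed
  \<comment> \<open>Vertex 4 attains the bound without wrapping: as n is at least 7, its neighbours
    1, 2, 6, 7 all lie in range.\<close>
  have "circulant_23_edge n 4 6" "circulant_23_edge n 4 7" "circulant_23_edge n 2 4" "circulant_23_edge n 1 4"
    using assms by (simp_all add: circulant_23_edge_def)
  then have "{{4, 6}, {4, 7}, {2, 4}, {1, 4}} \<subseteq> {e \<in> edges ?G. 4 \<in> e}"
    unfolding edges_circulant_23[OF assms] by blast
  moreover have "finite (edges ?G)"
    using card_edges_circulant_23[OF assms] assms by (intro card_ge_0_finite) simp
  ultimately have "card {{4, 6}, {4, 7}, {2, 4}, {1, 4 :: nat}} \<le> degree ?G 4"
    unfolding degree_def by (intro card_mono) simp_all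
  then have "degree ?G 4 = 4"
    using deg_le[of 4] by (simp add: doubleton_eq_iff)
  then show ?thesis
    unfolding max_degree_def verts using deg_le assms
    by (intro Max_eqI) (auto intro!: image_eqI[of _ _ 4])
qed

theorem theorem5:
  fixes n :: nat
  assumes "n \<ge> 7" and "odd n"
  shows "nearly_dispersable_wrt (circulant n {2, 3}) (odd_even_order n)"
proof -
  let ?G = "circulant n {2, 3}"
  \<comment> \<open>Used twice: for arbitrary \<open>\<omega>\<close> it excludes four pages, and
    for the constructed colouring it shows that all five colours actually occur, as
    \<open>num_pages\<close> requires.\<close>
  have five: "5 \<le> num_pages ?G c" if "matching_book_embedding ?G \<omega> c" for \<omega> c
  proof (rule ccontr)
    have "2 * n \<le> num_pages ?G c * (n div 2)"
      using card_edges_le_num_pages[OF that] card_edges_circulant_23[OF assms(1)]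
      by (simp add: circulant_def)
    moreover assume "\<not> 5 \<le> num_pages ?G c"
    then have "num_pages ?G c * (n div 2) \<le> 4 * (n div 2)"
      by (intro mult_le_mono1) simp
    moreover have "4 * (n div 2) < 2 * n"
      using assms(2) by (elim oddE) simp
    ultimately show False
      by linarith
  qed
  \<comment> \<open>\<open>Min\<close> and \<open>Max\<close> recover the increasing pair from the
    edge as a set.\<close>
  define c where "c e = (SOME p. on_page n p (Min e) (Max e))" for e
  have c: "on_page n (c {a, b}) a b" if "circulant_23_edge n a b" for a b
  proof -
    have "Min {a, b} = a" "Max {a, b} = b"
      using that by (simp_all add: circulant_23_edge_def)
    then show ?thesis
      unfolding c_def using someI_ex[OF on_page_exists[OF assms(2,1) that]] by simp
  qed
  have embedding: "matching_book_embedding ?G (odd_even_order n) c"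
    unfolding matching_book_embedding_def
  proof (intro conjI ballI impI)
    show "simple_graph ?G"
      using assms by (intro simple_graph_circulant) auto
    show "cyclic_order_on (verts ?G) (odd_even_order n)"
      by (rule cyclic_order_on_odd_even_order)
  next
    fix e f assume "e \<in> edges ?G" "f \<in> edges ?G" and ef: "e \<noteq> f \<and> c e = c f"
    then obtain a b a' b' where e: "e = {a, b}" "circulant_23_edge n a b"
      and f: "f = {a', b'}" "circulant_23_edge n a' b'"
      unfolding edges_circulant_23[OF assms(1)] by blast
    then have "e \<inter> f = {} \<and> \<not> edges_cross (odd_even_order n) e f"
      using on_page_compatible[OF assms(2,1) e(2) f(2), of "c e"] c[OF e(2)] c[OF f(2)] ef by auto
    then show "\<not> edges_cross (odd_even_order n) e f" "e \<inter> f = {}"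
      by blast+
  qed
  have "c ` edges ?G \<subseteq> {..<5}"
    using c on_page_less unfolding edges_circulant_23[OF assms(1)] by blast
  then have "num_pages ?G c \<le> 5"
    unfolding num_pages_def using card_mono[of "{..<5::nat}"] by fastforce
  then have "num_pages ?G c = 5"
    using five[OF embedding] by simp
  then show ?thesis
    using embedding five unfolding nearly_dispersable_wrt_def dispersable_def
      max_degree_circulant_23[OF assms(1)] by force
qed

end
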